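(* Let the step-size sequences of the A-SPDHG algorithm satisfy, for a random positive sequence $(\gamma^k)_{k\in\mathbb{N}}$, $$\tau^{k+1}=\frac{\tau^k}{\gamma^k},\qquad\sigma_i^{k+1}=\gamma^k\sigma_i^k,\qquad i\in\{1,\dots,n\},\ k\in\mathbb{N}.$$ Assume that $(\gamma^k)_{k\in\mathbb{N}}$ is $(\mathcal{F}^k)_{k\in\mathbb{N}}$-adapted, that the initial step-sizes are positive and satisfy $$\tau^0\sigma_i^0\frac{\|A_i\|^2}{p_i}<1,\qquad i\in\{1,\dots,n\},$$ and that there exists a deterministic sequence $(\epsilon^k)_{k\in\mathbb{N}}$ with values in $[0,1)$ such that $\sum_k\epsilon^k<\infty$ and, for all $k\in\mathbb{N}$, $$\min\{\gamma^k,(\gamma^k)^{-1}\}\ge1-\epsilon^k.$$ Then the step-size sequences satisfy the following three properties: (i) $(\tau^{k+1})_{k\in\mathbb{N}}$ and $(\sigma_i^{k+1})_{k\in\mathbb{N}}$, $i\in\{1,\dots,n\}$, are $(\mathcal{F}^k)_{k\in\mathbb{N}}$-adapted; (ii) there exists $\beta\in(0,1)$ such that $\tau^k\sigma_i^k\|A_i\|^2/p_i\le\beta<1$ for all $i\in\{1,\dots,n\}$ and $k\in\mathbb{N}$; (iii) $\tau^0$ and $\sigma_i^0$, $i\in\{1,\dots,n\}$, are positive and the sequences $(\tau^k)_{k\in\mathbb{N}}$ and $(\sigma_i^k)_{k\in\mathbb{N}}$, $i\in\{1,\dots,n\}$, are uniformly almost surely quasi-increasing.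
   Context: All Hilbert spaces are real. $X$ and $Y=Y_1\times\dots\times Y_n$ are separable Hilbert spaces, $A_i:X\to Y_i$ are bounded linear operators, $f_i:Y_i\to\mathbb{R}\cup\{+\infty\}$ and $g:X\to\mathbb{R}\cup\{+\infty\}$ are proper, convex, lower semi-continuous. $Ax=(A_1x,\dots,A_nx)$, and $f_i^*$ is the Fenchel conjugate of $f_i$. A-SPDHG algorithm (serial sampling): the inputs are deterministic initial points $x^0\in X$, $y^0\in Y$, deterministic initial step-sizes $\tau^0,\sigma_1^0,\dots,\sigma_n^0$, probabilities $p_i>0$ with $\sum_ip_i=1$, and a step-size update rule. Set $\bar y^0=y^0$. For $k=0,1,2,\dots$: 1. determine $\tau^{k+1}$ and $(\sigma_i^{k+1})_{1\le i\le n}$ by the update rule; 2. $x^{k+1}=\mathrm{prox}_{\tau^{k+1}g}(x^k-\tau^{k+1}A^*\bar y^k)$; 3. pick at random $i=I^k\in\{1,\dots,n\}$ with $\mathbb{P}(I^k=i)=p_i$, independently of the past; 4. $y_i^{k+1}=\mathrm{prox}_{\sigma_i^{k+1}f_i^*}(y_i^k+\sigma_i^{k+1}A_ix^{k+1})$ and $y_j^{k+1}=y_j^k$ for $j\ne i$; 5. $\bar y_i^{k+1}=y_i^{k+1}+\frac1{p_i}(y_i^{k+1}-y_i^k)$ and $\bar y_j^{k+1}=y_j^k$ for $j\neq i$. Here $\mathrm{prox}_{h}(u)=\arg\min_v\frac12\|v-u\|^2+h(v)$. Inequalities between random variables are understood almost surely. $\mathcal{F}^k$ is the $\sigma$-algebra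 generated by $(x^l,y^l)$, $0\le l\le k$. A sequence $(u^k)_{k\in\mathbb{N}}$ is $(\mathcal{F}^k)$-adapted if $u^k$ is $\mathcal{F}^k$-measurable for all $k\in\mathbb N$. A random positive real sequence $(u^k)_{k\in\mathbb{N}}$ is uniformly almost surely quasi-increasing if there is a deterministic sequence $(\eta^k)_{k\in\mathbb{N}}$ with values in $[0,1)$ such that $\sum_k\eta^k<\infty$ and, almost surely, $u^{k+1}\ge(1-\eta^k)u^k$ for all $k\in\mathbb{N}$. *)

theory Defs
  imports "HOL-Probability.Probability"
begin

text \<open>
  Encoding of the spaces.  A separable real Hilbert space is a type of class
  \<open>{real_inner, polish_space}\<close>.  The spaces \<open>Y_1, \<dots>, Y_n\<close> may differ from each other, so they
  are represented by closed subspaces \<open>Y i\<close> of one separable Hilbert space \<open>'y\<close>; this loses no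
  generality, as finitely many separable Hilbert spaces embed isometrically into their product.
  The index set \<open>{1, \<dots>, n}\<close> is a finite type \<open>'n\<close>, and an element of \<open>Y_1 \<times> \<dots> \<times> Y_n\<close> is
  a vector in \<open>'y ^ 'n\<close> whose \<open>i\<close>-th component lies in \<open>Y i\<close>.  Functions on \<open>Y i\<close> are
  given as functions on \<open>'y\<close> of which only the values on \<open>Y i\<close> are ever used.
\<close>

definition proper_on :: "'a set \<Rightarrow> ('a \<Rightarrow> ereal) \<Rightarrow> bool" where
  "proper_on S h \<longleftrightarrow> (\<forall>v\<in>S. h v \<noteq> -\<infinity>) \<and> (\<exists>v\<in>S. h v \<noteq> \<infinity>)"

definition ereal_convex_on :: "'a::real_vector set \<Rightarrow> ('a \<Rightarrow> ereal) \<Rightarrow> bool" where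
  "ereal_convex_on S h \<longleftrightarrow>
     (\<forall>u\<in>S. \<forall>v\<in>S. \<forall>t\<in>{0<..<1}.
        h ((1 - t) *\<^sub>R u + t *\<^sub>R v) \<le> ereal (1 - t) * h u + ereal t * h v)"

definition lsc_on :: "'a::topological_space set \<Rightarrow> ('a \<Rightarrow> ereal) \<Rightarrow> bool" where
  "lsc_on S h \<longleftrightarrow> (\<forall>v\<in>S. h v \<le> Liminf (at v within S) h)"

definition fenchel_conjugate :: "'a::real_inner set \<Rightarrow> ('a \<Rightarrow> ereal) \<Rightarrow> 'a \<Rightarrow> ereal" where
  "fenchel_conjugate S h w = (SUP v\<in>S. ereal (inner w v) - h v)"

definition prox :: "'a::real_inner set \<Rightarrow> ('a \<Rightarrow> ereal) \<Rightarrow> 'a \<Rightarrow> 'a" where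
  "prox S h u = arg_min (\<lambda>v. ereal (1 / 2 * (norm (v - u))\<^sup>2) + h v) (\<lambda>v. v \<in> S)"

definition history ::
  "'w measure \<Rightarrow> (nat \<Rightarrow> 'w \<Rightarrow> 'a::topological_space) \<Rightarrow> (nat \<Rightarrow> 'w \<Rightarrow> 'b::topological_space) \<Rightarrow>
     nat \<Rightarrow> 'w measure" where
  "history M x y k = sigma (space M)
     (\<Union>l\<in>{..k}. sets (vimage_algebra (space M) (x l) borel) \<union>
                 sets (vimage_algebra (space M) (y l) borel))"

definition adapted :: "(nat \<Rightarrow> 'w measure) \<Rightarrow> (nat \<Rightarrow> 'w \<Rightarrow> real) \<Rightarrow> bool" where
  "adapted F u \<longleftrightarrow> (\<forall>k. u k \<in> borel_measurable (F k))"

definition random_positive :: "'w measure \<Rightarrow> (nat \<Rightarrow> 'w \<Rightarrow> real) \<Rightarrow> bool" where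
  "random_positive M u \<longleftrightarrow>
     (\<forall>k. u k \<in> borel_measurable M) \<and> (\<forall>k. \<forall>\<omega>\<in>space M. 0 < u k \<omega>)"

definition ua_quasi_increasing :: "'w measure \<Rightarrow> (nat \<Rightarrow> 'w \<Rightarrow> real) \<Rightarrow> bool" where
  "ua_quasi_increasing M u \<longleftrightarrow>
     random_positive M u \<and>
     (\<exists>\<eta>::nat \<Rightarrow> real. (\<forall>k. \<eta> k \<in> {0..<1}) \<and> summable \<eta> \<and>
        (AE \<omega> in M. \<forall>k. u (Suc k) \<omega> \<ge> (1 - \<eta> k) * u k \<omega>))"

text \<open>
  The \<open>\<sigma>\<close>-algebra of everything computed or drawn before the index \<open>I k\<close> is picked: the iterates
  \<open>y\<^sup>l\<close>, \<open>ybar\<^sup>l\<close> for \<open>l \<le> k\<close>, the iterates \<open>x\<^sup>l\<close> and the step-sizes for \<open>l \<le> k + 1\<close>, and the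
  indices \<open>I\<^sup>l\<close> for \<open>l < k\<close>.
\<close>

definition past ::
  "'w measure \<Rightarrow> (nat \<Rightarrow> 'w \<Rightarrow> 'x::topological_space) \<Rightarrow>
     (nat \<Rightarrow> 'w \<Rightarrow> 'y::topological_space) \<Rightarrow> (nat \<Rightarrow> 'w \<Rightarrow> 'y) \<Rightarrow> (nat \<Rightarrow> 'w \<Rightarrow> real) \<Rightarrow>
     ('n \<Rightarrow> nat \<Rightarrow> 'w \<Rightarrow> real) \<Rightarrow> (nat \<Rightarrow> 'w \<Rightarrow> 'n) \<Rightarrow> nat \<Rightarrow> 'w measure" where
  "past M x y ybar \<tau> \<sigma> I k = sigma (space M)
     ((\<Union>l\<in>{..k}. sets (vimage_algebra (space M) (y l) borel) \<union>
                  sets (vimage_algebra (space M) (ybar l) borel)) \<union>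
      (\<Union>l\<in>{..Suc k}. sets (vimage_algebra (space M) (x l) borel) \<union>
                      sets (vimage_algebra (space M) (\<tau> l) borel) \<union>
                      (\<Union>i. sets (vimage_algebra (space M) (\<sigma> i l) borel))) \<union>
      (\<Union>l\<in>{..<k}. sets (vimage_algebra (space M) (I l) (count_space UNIV))))"

text \<open>
  A run of A-SPDHG with serial sampling on the probability space \<open>M\<close>.  The step-size update rule is
  left open: \<open>\<tau>\<close> and \<open>\<sigma>\<close> are random sequences with deterministic initial values, the only
  constraint being that the step-sizes of index \<open>k + 1\<close> are determined before \<open>I k\<close> is drawn.
\<close>

locale a_spdhg = prob_space M
  for M :: "'w measure" +
  fixes Y :: "'n::finite \<Rightarrow> 'y::{real_inner, polish_space} set"
    and A :: "'n \<Rightarrow> 'x::{real_inner, polish_space} \<Rightarrow> 'y"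
    and f :: "'n \<Rightarrow> 'y \<Rightarrow> ereal"
    and g :: "'x \<Rightarrow> ereal"
    and p :: "'n \<Rightarrow> real"
    and x0 :: 'x
    and y0 :: "'y ^ 'n"
    and \<tau>0 :: real
    and \<sigma>0 :: "'n \<Rightarrow> real"
    and \<tau> :: "nat \<Rightarrow> 'w \<Rightarrow> real"
    and \<sigma> :: "'n \<Rightarrow> nat \<Rightarrow> 'w \<Rightarrow> real"
    and x :: "nat \<Rightarrow> 'w \<Rightarrow> 'x"
    and y ybar :: "nat \<Rightarrow> 'w \<Rightarrow> 'y ^ 'n"
    and I :: "nat \<Rightarrow> 'w \<Rightarrow> 'n"
  assumes Y_subspace: "\<And>i. subspace (Y i)"
    and Y_closed: "\<And>i. closed (Y i)"
    and A_bounded_linear: "\<And>i. bounded_linear (A i)"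
    and A_range: "\<And>i. range (A i) \<subseteq> Y i"
    and f_proper: "\<And>i. proper_on (Y i) (f i)"
    and f_convex: "\<And>i. ereal_convex_on (Y i) (f i)"
    and f_lsc: "\<And>i. lsc_on (Y i) (f i)"
    and g_proper: "proper_on UNIV g"
    and g_convex: "ereal_convex_on UNIV g"
    and g_lsc: "lsc_on UNIV g"
    and p_pos: "\<And>i. 0 < p i"
    and p_sum: "(\<Sum>i\<in>UNIV. p i) = 1"
    and y0_in: "\<And>i. y0 $ i \<in> Y i"
    and x_random: "\<And>k. x k \<in> borel_measurable M"
    and y_random: "\<And>k. y k \<in> borel_measurable M"
    and ybar_random: "\<And>k. ybar k \<in> borel_measurable M"
    and \<tau>_random: "\<And>k. \<tau> k \<in> borel_measurable M"
    and \<sigma>_random: "\<And>i k. \<sigma> i k \<in> borel_measurable M"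
    and I_random: "\<And>k. I k \<in> measurable M (count_space UNIV)"
    and x_init: "\<And>\<omega>. \<omega> \<in> space M \<Longrightarrow> x 0 \<omega> = x0"
    and y_init: "\<And>\<omega>. \<omega> \<in> space M \<Longrightarrow> y 0 \<omega> = y0"
    and ybar_init: "\<And>\<omega>. \<omega> \<in> space M \<Longrightarrow> ybar 0 \<omega> = y0"
    and \<tau>_init: "\<And>\<omega>. \<omega> \<in> space M \<Longrightarrow> \<tau> 0 \<omega> = \<tau>0"
    and \<sigma>_init: "\<And>i \<omega>. \<omega> \<in> space M \<Longrightarrow> \<sigma> i 0 \<omega> = \<sigma>0 i"
    and x_step: "\<And>k \<omega>. \<omega> \<in> space M \<Longrightarrow>
          x (Suc k) \<omega> =
            prox UNIV (\<lambda>v. ereal (\<tau> (Suc k) \<omega>) * g v)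
              (x k \<omega> - \<tau> (Suc k) \<omega> *\<^sub>R adjoint (\<lambda>u. \<chi> i. A i u) (ybar k \<omega>))"
    and I_distr: "\<And>k i. prob {\<omega> \<in> space M. I k \<omega> = i} = p i"
    and I_indep: "\<And>k. indep_set (sets (past M x y ybar \<tau> \<sigma> I k))
          (sets (vimage_algebra (space M) (I k) (count_space UNIV)))"
    and y_step: "\<And>k \<omega>. \<omega> \<in> space M \<Longrightarrow>
          y (Suc k) \<omega> = (\<chi> i.
            if i = I k \<omega>
            then prox (Y i)
                   (\<lambda>v. ereal (\<sigma> i (Suc k) \<omega>) * fenchel_conjugate (Y i) (f i) v)
                   (y k \<omega> $ i + \<sigma> i (Suc k) \<omega> *\<^sub>R A i (x (Suc k) \<omega>))
            else y k \<omega> $ i)"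
    and ybar_step: "\<And>k \<omega>. \<omega> \<in> space M \<Longrightarrow>
          ybar (Suc k) \<omega> = (\<chi> i.
            if i = I k \<omega>
            then y (Suc k) \<omega> $ i + (1 / p i) *\<^sub>R (y (Suc k) \<omega> $ i - y k \<omega> $ i)
            else y k \<omega> $ i)"

end

theory Submission
  imports Defs
begin

text \<open>Every step-size sequence has the form u^{k+1} = c^k u^k with deterministic positive u^0,
  where c = 1/\<gamma> for \<open>\<tau>\<close> and c = \<gamma> for each
  \<open>\<sigma> i\<close>. All three properties follow from this multiplicative structure; nothing
  about the iterates matters beyond the filtration they generate. Adaptedness
  (\<open>adapted_recursive_product\<close>): u^{k+1} is a product of u^0 and c^0, ..., c^k, all
  known at time k. Quasi-increase (\<open>ua_quasi_increasing_recursive_product\<close>): the bound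
  on min{\<gamma>, 1/\<gamma>} gives c^k \<ge> 1 - \<epsilon>^k for both choices of c, so \<eta> =
  \<epsilon> serves. Uniform bound: the factors \<gamma> and 1/\<gamma> cancel in \<tau>^k
  \<sigma>_i^k, which therefore keeps its initial value, and finitely many numbers below 1 have a
  common bound below 1.\<close>

lemma space_history [simp]: "space (history M x y k) = space M"
  by (simp add: history_def space_measure_of_conv)

lemma subalgebra_history_mono:
  assumes "k \<le> l"
  shows "subalgebra (history M x y l) (history M x y k)"
proof -
  define G where "G j = (\<Union>l\<in>{..j}. sets (vimage_algebra (space M) (x l) borel) \<union>
                 sets (vimage_algebra (space M) (y l) borel))" for j :: nat
  \<comment> \<open>Needed because \<open>sigma\<close> gives the generated sigma-algebra only for
    generators inside the power set of the space, and a trivial one otherwise.\<close>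
  have "G j \<subseteq> Pow (space M)" for j
    using sets.sets_into_space by (fastforce simp: G_def)
  then have sets: "sets (history M x y j) = sigma_sets (space M) (G j)" for j
    by (simp add: history_def G_def)
  have "G k \<subseteq> G l"
    using assms by (fastforce simp: G_def)
  then show ?thesis
    by (simp add: subalgebra_def sets sigma_sets_mono')
qed

text \<open>The index shift is the point: going from u^k to u^{k+1} uses c^k, so u^{k+1} is known at
  time k, one step before its own index.\<close>

lemma adapted_recursive_product:
  assumes "adapted (history M x y) c"
    and "\<And>\<omega>. \<omega> \<in> space M \<Longrightarrow> u 0 \<omega> = u0"
    and "\<And>k \<omega>. \<omega> \<in> space M \<Longrightarrow> u (Suc k) \<omega> = c k \<omega> * u k \<omega>"
  shows "adapted (history M x y) (\<lambda>k. u (Suc k))"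
  unfolding adapted_def
proof
  fix k
  have c: "c k \<in> borel_measurable (history M x y k)" for k
    using assms(1) by (simp add: adapted_def)
  have step: "u (Suc k) \<in> borel_measurable (history M x y k)"
    if "u k \<in> borel_measurable (history M x y k)" for k
  proof -
    have "(\<lambda>\<omega>. c k \<omega> * u k \<omega>) \<in> borel_measurable (history M x y k)"
      using c that by (rule borel_measurable_times)
    then show ?thesis
      by (subst measurable_cong[where g = "\<lambda>\<omega>. c k \<omega> * u k \<omega>"]) (simp_all add: assms(3))
  qed
  show "u (Suc k) \<in> borel_measurable (history M x y k)"
  proof (induction k)
    case 0
    have "u 0 \<in> borel_measurable (history M x y 0)"
      by (subst measurable_cong[where g = "\<lambda>_. u0"]) (simp_all add: assms(2))
    then show ?case by (rule step)
  next
    case (Suc k)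
    \<comment> \<open>The induction hypothesis holds for the smaller sigma-algebra at time k;
      monotonicity of the filtration lifts it to where \<open>step\<close> applies.\<close>
    have "u (Suc k) \<in> borel_measurable (history M x y (Suc k))"
      using subalgebra_history_mono[OF le_SucI[OF order_refl]] Suc
      by (rule measurable_from_subalg)
    then show ?case by (rule step)
  qed
qed

lemma random_positive_inverse:
  assumes "random_positive M c"
  shows "random_positive M (\<lambda>k \<omega>. inverse (c k \<omega>))"
  using assms by (auto simp: random_positive_def intro: borel_measurable_inverse)

lemma random_positive_recursive_product:
  assumes "random_positive M c" and "0 < u0"
    and "\<And>\<omega>. \<omega> \<in> space M \<Longrightarrow> u 0 \<omega> = u0"
    and "\<And>k \<omega>. \<omega> \<in> space M \<Longrightarrow> u (Suc k) \<omega> = c k \<omega> * u k \<omega>"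
  shows "random_positive M u"
proof -
  have "u k \<in> borel_measurable M \<and> (\<forall>\<omega>\<in>space M. 0 < u k \<omega>)" for k
  proof (induction k)
    case 0
    have "u 0 \<in> borel_measurable M"
      by (subst measurable_cong[where g = "\<lambda>_. u0"]) (simp_all add: assms(3))
    then show ?case using assms(2,3) by simp
  next
    case (Suc k)
    have "(\<lambda>\<omega>. c k \<omega> * u k \<omega>) \<in> borel_measurable M"
      using assms(1) Suc by (simp add: random_positive_def borel_measurable_times)
    then have "u (Suc k) \<in> borel_measurable M"
      by (subst measurable_cong[where g = "\<lambda>\<omega>. c k \<omega> * u k \<omega>"]) (simp_all add: assms(4))
    then show ?case
      using assms(1,4) Suc by (simp add: random_positive_def)
  qed
  then show ?thesis by (simp add: random_positive_def)
qed

text \<open>Multiplying 1 - \<eta>^k \<le> c^k by u^k preserves the inequality, since u stays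
  positive on the whole space.\<close>

lemma ua_quasi_increasing_recursive_product:
  assumes "random_positive M c" and "0 < u0"
    and "\<And>\<omega>. \<omega> \<in> space M \<Longrightarrow> u 0 \<omega> = u0"
    and "\<And>k \<omega>. \<omega> \<in> space M \<Longrightarrow> u (Suc k) \<omega> = c k \<omega> * u k \<omega>"
    and "\<And>k. \<eta> k \<in> {0..<1}" and "summable \<eta>"
    and "AE \<omega> in M. \<forall>k. 1 - \<eta> k \<le> c k \<omega>"
  shows "ua_quasi_increasing M u"
proof -
  have pos: "random_positive M u"
    using assms(1-4) by (rule random_positive_recursive_product)
  have "AE \<omega> in M. \<forall>k. (1 - \<eta> k) * u k \<omega> \<le> u (Suc k) \<omega>"
    using assms(7) AE_space
  proof eventually_elim
    case (elim \<omega>)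
    then show ?case
      using pos by (auto simp: assms(4) random_positive_def less_imp_le intro!: mult_right_mono)
  qed
  with pos assms(5,6) show ?thesis
    by (auto simp: ua_quasi_increasing_def)
qed

lemma finite_family_bound_less_one:
  fixes a :: "'n::finite \<Rightarrow> real"
  assumes "\<And>i. a i < 1"
  obtains \<beta> where "\<beta> \<in> {0<..<1}" and "\<And>i. a i \<le> \<beta>"
proof
  \<comment> \<open>Inserting 1/2 keeps the maximum strictly positive even if every a_i is zero or
    negative, as happens when all the operators vanish.\<close>
  let ?\<beta> = "Max (insert (1/2) (range a))"
  have "1/2 \<le> ?\<beta>" by (rule Max_ge) auto
  then show "?\<beta> \<in> {0<..<1}" using assms by auto
  show "a i \<le> ?\<beta>" for i by (rule Max_ge) auto
qed

theorem lemma2p2: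
  fixes M :: "'w measure"
    and Y :: "'n::finite \<Rightarrow> 'y::{real_inner, polish_space} set"
    and A :: "'n \<Rightarrow> 'x::{real_inner, polish_space} \<Rightarrow> 'y"
    and f :: "'n \<Rightarrow> 'y \<Rightarrow> ereal"
    and g :: "'x \<Rightarrow> ereal"
    and p :: "'n \<Rightarrow> real"
    and x0 :: 'x
    and y0 :: "'y ^ 'n"
    and \<tau>0 :: real
    and \<sigma>0 :: "'n \<Rightarrow> real"
    and \<tau> :: "nat \<Rightarrow> 'w \<Rightarrow> real"
    and \<sigma> :: "'n \<Rightarrow> nat \<Rightarrow> 'w \<Rightarrow> real"
    and x :: "nat \<Rightarrow> 'w \<Rightarrow> 'x"
    and y ybar :: "nat \<Rightarrow> 'w \<Rightarrow> 'y ^ 'n"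
    and I :: "nat \<Rightarrow> 'w \<Rightarrow> 'n"
    and \<gamma> :: "nat \<Rightarrow> 'w \<Rightarrow> real"
    and \<epsilon> :: "nat \<Rightarrow> real"
  assumes alg: "a_spdhg M Y A f g p x0 y0 \<tau>0 \<sigma>0 \<tau> \<sigma> x y ybar I"
    and \<gamma>_pos: "random_positive M \<gamma>"
    and \<tau>_rule: "\<And>k \<omega>. \<omega> \<in> space M \<Longrightarrow> \<tau> (Suc k) \<omega> = \<tau> k \<omega> / \<gamma> k \<omega>"
    and \<sigma>_rule: "\<And>i k \<omega>. \<omega> \<in> space M \<Longrightarrow> \<sigma> i (Suc k) \<omega> = \<gamma> k \<omega> * \<sigma> i k \<omega>"
    and \<gamma>_adapted: "adapted (history M x y) \<gamma>"
    and \<tau>0_pos: "0 < \<tau>0"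
    and \<sigma>0_pos: "\<And>i. 0 < \<sigma>0 i"
    and init: "\<And>i. \<tau>0 * \<sigma>0 i * ((onorm (A i))\<^sup>2 / p i) < 1"
    and \<epsilon>_range: "\<And>k. \<epsilon> k \<in> {0..<1}"
    and \<epsilon>_summable: "summable \<epsilon>"
    and \<gamma>_bound: "AE \<omega> in M. \<forall>k. min (\<gamma> k \<omega>) (inverse (\<gamma> k \<omega>)) \<ge> 1 - \<epsilon> k"
  shows "(adapted (history M x y) (\<lambda>k. \<tau> (Suc k)) \<and>
          (\<forall>i. adapted (history M x y) (\<lambda>k. \<sigma> i (Suc k)))) \<and>
         (\<exists>\<beta>\<in>{0<..<1::real}. AE \<omega> in M. \<forall>i k.
            \<tau> k \<omega> * \<sigma> i k \<omega> * ((onorm (A i))\<^sup>2 / p i) \<le> \<beta>) \<and>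
         (0 < \<tau>0 \<and> (\<forall>i. 0 < \<sigma>0 i) \<and>
          ua_quasi_increasing M \<tau> \<and> (\<forall>i. ua_quasi_increasing M (\<sigma> i)))"
proof -
  interpret a_spdhg M Y A f g p x0 y0 \<tau>0 \<sigma>0 \<tau> \<sigma> x y ybar I
    by (rule alg)
  let ?c = "\<lambda>k \<omega>. inverse (\<gamma> k \<omega>)"
  have \<tau>_rec: "\<tau> (Suc k) \<omega> = ?c k \<omega> * \<tau> k \<omega>" if "\<omega> \<in> space M" for k \<omega>
    using \<tau>_rule[OF that] by (simp add: field_simps)
  have "adapted (history M x y) ?c"
    using \<gamma>_adapted by (auto simp: adapted_def intro: borel_measurable_inverse)
  then have adapted_\<tau>: "adapted (history M x y) (\<lambda>k. \<tau> (Suc k))"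
    using \<tau>_init \<tau>_rec by (rule adapted_recursive_product)
  have adapted_\<sigma>: "adapted (history M x y) (\<lambda>k. \<sigma> i (Suc k))" for i
    using \<gamma>_adapted \<sigma>_init \<sigma>_rule by (rule adapted_recursive_product)

  \<comment> \<open>The invariant behind the uniform bound. It needs \<gamma>^k to be nonzero, since
    division by zero yields 0 and would destroy the cancellation.\<close>
  have product: "\<tau> k \<omega> * \<sigma> i k \<omega> = \<tau>0 * \<sigma>0 i" if "\<omega> \<in> space M" for i k \<omega>
  proof (induction k)
    case 0
    show ?case using that by (simp add: \<tau>_init \<sigma>_init)
  next
    case (Suc k)
    have "\<gamma> k \<omega> \<noteq> 0"
      using \<gamma>_pos that by (metis random_positive_def less_irrefl)
    then show ?case
      using Suc that by (simp add: \<tau>_rule \<sigma>_rule)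
  qed
  obtain \<beta> where \<beta>: "\<beta> \<in> {0<..<1}" "\<And>i. \<tau>0 * \<sigma>0 i * ((onorm (A i))\<^sup>2 / p i) \<le> \<beta>"
    using finite_family_bound_less_one[of "\<lambda>i. \<tau>0 * \<sigma>0 i * ((onorm (A i))\<^sup>2 / p i)"] init
    by blast
  have bound: "AE \<omega> in M. \<forall>i k. \<tau> k \<omega> * \<sigma> i k \<omega> * ((onorm (A i))\<^sup>2 / p i) \<le> \<beta>"
    using \<beta>(2) by (intro AE_I2 allI) (simp only: product)

  \<comment> \<open>The 1/\<gamma> entry of the minimum controls \<open>\<tau>\<close>; the \<gamma>
    entry controls every \<open>\<sigma> i\<close> below.\<close>
  have "AE \<omega> in M. \<forall>k. 1 - \<epsilon> k \<le> ?c k \<omega>"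
    using \<gamma>_bound by eventually_elim simp
  with random_positive_inverse[OF \<gamma>_pos] \<tau>0_pos \<tau>_init \<tau>_rec \<epsilon>_range \<epsilon>_summable
  have "ua_quasi_increasing M \<tau>"
    by (rule ua_quasi_increasing_recursive_product)
  moreover have "AE \<omega> in M. \<forall>k. 1 - \<epsilon> k \<le> \<gamma> k \<omega>"
    using \<gamma>_bound by eventually_elim simp
  with \<gamma>_pos \<sigma>0_pos \<sigma>_init \<sigma>_rule \<epsilon>_range \<epsilon>_summable
  have "ua_quasi_increasing M (\<sigma> i)" for i
    by (rule ua_quasi_increasing_recursive_product)
  ultimately show ?thesis
    using adapted_\<tau> adapted_\<sigma> \<beta>(1) bound \<tau>0_pos \<sigma>0_pos by blast
qed

end
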